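(* Let $n\ge 2$. A $V$-description of $H_n$ is obtained by taking the extreme rays $(S,w)$ of $P_{m(n),n}$, projecting them to the $S$ coordinates, and removing both the trivial rays and the redundant rays. That is, $H_n$ is the conical hull of the finite set of vectors $S$ for which $(S,w)$ is a non-trivial extreme ray of $P_{m(n),n}$ for some $w$, and after removing redundant rays from this set one is left exactly with the extreme rays of $H_n$.
   Context: For a positive integer $k$ let $[k]=\{1,\dots,k\}$. $K_N$ is the undirected complete graph on vertex set $[N]$, with edge set $E_N=\{(i,j):1\le i<j\le N\}$. For a vector $w=(w(e))_{e\in E_N}$ and $W\subseteq[N]$, the cut $C(W)$ is the set of edges with exactly one endpoint in $W$, and $\|C(W)\|=\sum_{e\in C(W)}w(e)$. For $n<N$, a nonnegative $w$ on $K_N$ realizes in $K_N$ the vector $S=(S_I)_{\varnothing\ne I\subseteq[n]}\in\mathbb{R}^{2^n-1}$ with $S_I=\min\{\|C(W)\| : W\subseteq[N-1],\ W\cap[n]=I\}$. $H_n$ is the set of all $S\in\mathbb{R}^{2^n-1}$ realized by some nonnegative $w$ in $K_N$ for some $N>n$ (it is a convex polyhedral cone). The integer $m(n)$ is the smallest integer such that every $S\in H_n$ can be realized in $K_{m(n)}$ (such an integer exists). $P_{N,n}$ is the cone of all $(S,w)\in\mathbb{R}^{2^n-1}\times\mathbb{R}^{E_N}$ satisfying $$S_I\le\|C(W)\|\quad\text{for all } W\subseteq[N-1],\ \varnothing\ne I\subseteq[n]\text{ with } I=W\cap[n],\qquad w(e)\ge 0\quad\text{for all } e\in E_N.$$ Extreme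 rays are identified with their nonzero generating vectors up to positive scaling. An extreme ray of $P_{N,n}$ is trivial if (up to positive scaling) it has either exactly one $S_I=-1$ and all other coordinates zero, or exactly one $w(e)=1$ and all other coordinates zero; otherwise it is non-trivial. A ray in a finite set is redundant if it lies in the conical hull of the other rays in the set (rays being taken up to positive scaling). A $V$-description (or $V$-representation) of a polyhedral cone is a non-redundant list of its extreme rays. *)

theory Defs
  imports "HOL-Analysis.Analysis" "HOL-Library.Function_Algebras"
begin

text \<open>
  Pointwise scaling completes the pointwise operations of \<open>Function_Algebras\<close> to a real vector
  space, so that the library notions \<open>face_of\<close>, \<open>conic hull\<close> and \<open>convex_cone hull\<close> apply to
  real-valued functions. \<open>conic hull {x}\<close> is the closed half-line generated by \<open>x\<close>, and
  \<open>convex_cone hull A\<close> is the conical hull of \<open>A\<close> (it contains \<open>0\<close>, also for empty \<open>A\<close>).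
\<close>

instantiation "fun" :: (type, real_vector) real_vector
begin

definition scaleR_fun :: "real \<Rightarrow> ('a \<Rightarrow> 'b) \<Rightarrow> 'a \<Rightarrow> 'b"
  where "scaleR_fun c f = (\<lambda>x. c *\<^sub>R f x)"

instance
  by standard (auto simp: scaleR_fun_def fun_eq_iff scaleR_add_left scaleR_add_right)

end


section \<open>Extreme rays and V-descriptions\<close>

definition extreme_rays :: "'a::real_vector set \<Rightarrow> 'a set set"
  where "extreme_rays C = {r. (\<exists>x. x \<noteq> 0 \<and> r = conic hull {x}) \<and> r face_of C}"

definition redundant :: "'a::real_vector set set \<Rightarrow> 'a set \<Rightarrow> bool"
  where "redundant R r \<longleftrightarrow> r \<in> R \<and> r \<subseteq> convex_cone hull (\<Union>(R - {r}))"

definition remove_redundant :: "'a::real_vector set set \<Rightarrow> 'a set set"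
  where "remove_redundant R = {r \<in> R. \<not> redundant R r}"

definition V_description :: "'a::real_vector set set \<Rightarrow> 'a set \<Rightarrow> bool"
  where "V_description R C \<longleftrightarrow>
    finite R \<and> R = extreme_rays C \<and> (\<forall>r\<in>R. \<not> redundant R r) \<and> C = convex_cone hull (\<Union>R)"


section \<open>Cuts in complete graphs\<close>

text \<open>
  The coordinate space \<open>\<real>\<^sup>A\<close> of a finite index set \<open>A\<close> is represented by the functions
  vanishing outside \<open>A\<close>, so that a vector is determined by its coordinates.
\<close>

definition vecs :: "'i set \<Rightarrow> ('i \<Rightarrow> real) set"
  where "vecs A = {f. \<forall>x. x \<notin> A \<longrightarrow> f x = 0}"

definition unit_vec :: "'i \<Rightarrow> 'i \<Rightarrow> real"
  where "unit_vec i = (\<lambda>j. if j = i then 1 else 0)"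

definition edges :: "nat \<Rightarrow> (nat \<times> nat) set"
  where "edges N = {(i, j). 1 \<le> i \<and> i < j \<and> j \<le> N}"

definition terminal_sets :: "nat \<Rightarrow> nat set set"
  where "terminal_sets n = {I. I \<noteq> {} \<and> I \<subseteq> {1..n}}"

definition cut :: "nat \<Rightarrow> nat set \<Rightarrow> (nat \<times> nat) set"
  where "cut N W = {(i, j) \<in> edges N. (i \<in> W) \<noteq> (j \<in> W)}"

definition cut_weight :: "nat \<Rightarrow> (nat \<times> nat \<Rightarrow> real) \<Rightarrow> nat set \<Rightarrow> real"
  where "cut_weight N w W = (\<Sum>e\<in>cut N W. w e)"

definition realizes :: "nat \<Rightarrow> nat \<Rightarrow> (nat \<times> nat \<Rightarrow> real) \<Rightarrow> (nat set \<Rightarrow> real) \<Rightarrow> bool"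
  where "realizes n N w S \<longleftrightarrow>
    n < N \<and> w \<in> vecs (edges N) \<and> (\<forall>e\<in>edges N. 0 \<le> w e) \<and>
    S \<in> vecs (terminal_sets n) \<and>
    (\<forall>I\<in>terminal_sets n.
       S I = Min {cut_weight N w W |W. W \<subseteq> {1..N - 1} \<and> W \<inter> {1..n} = I})"

definition H_cone :: "nat \<Rightarrow> (nat set \<Rightarrow> real) set"
  where "H_cone n = {S. \<exists>N w. realizes n N w S}"

definition m_min :: "nat \<Rightarrow> nat"
  where "m_min n = (LEAST N. \<forall>S\<in>H_cone n. \<exists>w. realizes n N w S)"

definition P_cone :: "nat \<Rightarrow> nat \<Rightarrow> ((nat set \<Rightarrow> real) \<times> (nat \<times> nat \<Rightarrow> real)) set"
  where "P_cone N n = {(S, w).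
    S \<in> vecs (terminal_sets n) \<and> w \<in> vecs (edges N) \<and>
    (\<forall>W I. W \<subseteq> {1..N - 1} \<and> I \<in> terminal_sets n \<and> I = W \<inter> {1..n} \<longrightarrow>
       S I \<le> cut_weight N w W) \<and>
    (\<forall>e\<in>edges N. 0 \<le> w e)}"

definition trivial_rays ::
    "nat \<Rightarrow> nat \<Rightarrow> ((nat set \<Rightarrow> real) \<times> (nat \<times> nat \<Rightarrow> real)) set set"
  where "trivial_rays N n =
    {conic hull {(- unit_vec I, 0)} |I. I \<in> terminal_sets n} \<union>
    {conic hull {(0, unit_vec e)} |e. e \<in> edges N}"

text \<open>
  Since \<open>fst\<close> is linear, the image under \<open>fst\<close> of the half-line generated by \<open>(S, w)\<close> is
  \<open>conic hull {S}\<close>.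
\<close>

definition projected_rays :: "nat \<Rightarrow> (nat set \<Rightarrow> real) set set"
  where "projected_rays n = (\<lambda>r. fst ` r) ` (extreme_rays (P_cone (m_min n) n) - trivial_rays (m_min n) n)"

end

theory Submission
  imports Defs
begin

text \<open>
  A nonnegative weight vector can be pushed forward along a vertex map fixing the terminals. Merging
  the vertices that no chosen minimum cut separates shows that \<open>m(n)\<close> exists, and gluing two networks
  along their terminals shows that \<open>H_cone n\<close> is closed under addition. The pointed cone
  \<open>P_cone (m_min n) n\<close> is finitely generated, hence spanned by its extreme rays. On a non-trivial
  extreme ray every \<open>S I\<close> is attained by a cut, so its projection lies in \<open>H_cone n\<close>; conversely a
  realized \<open>S\<close> has no slack that a trivial ray could contribute to. Finally, in a pointed cone the
  irredundant rays of any finite generating set are exactly the extreme rays.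
\<close>

section \<open>Finitely generated cones\<close>

lemma convex_cone_conic_hull_singleton: "convex_cone (conic hull {x})"
  by (simp add: convex_cone_def conic_hull_eq_empty convex_conic_hull conic_conic_hull)

lemma mem_conic_hull_singleton: "y \<in> conic hull {x} \<longleftrightarrow> (\<exists>c\<ge>0. y = c *\<^sub>R x)"
  by (auto simp: conic_hull_explicit)

lemma conic_hull_singleton_eqI:
  assumes "y \<in> conic hull {x}" "y \<noteq> 0"
  shows "conic hull {y} = conic hull {x}"
proof -
  obtain c where c: "c \<ge> 0" "y = c *\<^sub>R x"
    using assms(1) by (auto simp: mem_conic_hull_singleton)
  with assms(2) have "c > 0"
    by (cases "c = 0") auto
  then show ?thesis
    using conic_hull_image_scale[of "{x}" "\<lambda>_. c"] c by simp
qed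

lemma linear_image_conic_hull_singleton: "linear f \<Longrightarrow> f ` (conic hull {x}) = conic hull {f x}"
  using conic_hull_linear_image[of f "{x}"] by simp

lemma linear_halfspace_convex_cone:
  fixes f :: "'a::real_vector \<Rightarrow> real"
  assumes "linear f"
  shows "convex_cone {x. 0 \<le> f x}"
  using assms by (auto simp: convex_cone_iff linear_add linear_scale linear_0)

lemma convex_cone_Int: "convex_cone S \<Longrightarrow> convex_cone T \<Longrightarrow> convex_cone (S \<inter> T)"
  by (simp add: convex_cone_iff)

lemma convex_cone_hull_subset_iff: "convex_cone T \<Longrightarrow> convex_cone hull S \<subseteq> T \<longleftrightarrow> S \<subseteq> T"
  by (rule subset_hull)

lemma convex_cone_hull_UnE:
  assumes "x \<in> convex_cone hull (S \<union> T)"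
  obtains y z where "y \<in> convex_cone hull S" "z \<in> convex_cone hull T" "x = y + z"
  using assms by (auto simp: convex_cone_hull_Un)

lemma convex_cone_sum:
  assumes "convex_cone C" "\<And>i. i \<in> A \<Longrightarrow> x i \<in> C"
  shows "(\<Sum>i\<in>A. x i) \<in> C"
  using assms(2)
  by (induction A rule: infinite_finite_induct)
    (auto simp: convex_cone_contains_0[OF assms(1)] intro: convex_cone_add[OF assms(1)])

text \<open>
  One step of the double description method: the new generators are the old ones in the halfspace
  together with, for each pair on opposite sides, their positive combination in the hyperplane.
\<close>

lemma finitely_generated_Int_halfspace:
  fixes f :: "'a::real_vector \<Rightarrow> real"
  assumes f: "linear f" and G: "finite G"
  shows "\<exists>G'. finite G' \<and> convex_cone hull G' = {x \<in> convex_cone hull G. 0 \<le> f x}"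
proof -
  define B where "B p q = f p *\<^sub>R q - f q *\<^sub>R p" for p q
  define P where "P = {g \<in> G. 0 \<le> f g}"
  define Q where "Q = {g \<in> G. f g < 0}"
  define K where "K = convex_cone hull (P \<union> (\<lambda>(p, q). B p q) ` (P \<times> Q))"
  have K: "convex_cone K"
    by (simp add: K_def convex_cone_convex_cone_hull)
  have fB: "f (B p q) = 0" for p q
    by (simp add: B_def linear_diff[OF f] linear_scale[OF f])
  have PK: "convex_cone hull P \<subseteq> K"
    unfolding K_def by (rule hull_mono) blast
  have "convex_cone hull P \<subseteq> {p. 0 \<le> f p}"
    using linear_halfspace_convex_cone[OF f] by (auto simp: convex_cone_hull_subset_iff P_def)
  then have nonneg: "0 \<le> f p" if "p \<in> convex_cone hull P" for p
    using that by blast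
  have "B p q \<in> K" if "p \<in> P" "q \<in> Q" for p q
    unfolding K_def by (rule hull_inc) (use that in blast)
  \<comment> \<open>\<open>B\<close> is linear in each argument, so membership of
    \<open>B p q\<close> in \<open>K\<close> passes from generators to hulls, first in
    \<open>p\<close> and then in \<open>q\<close>.\<close>
  moreover have "convex_cone {p. B p q \<in> K}" for q
  proof -
    have "B (x + y) q = B x q + B y q" "B (c *\<^sub>R x) q = c *\<^sub>R B x q" "B 0 q = 0" for x y c
      by (simp_all add: B_def linear_add[OF f] linear_scale[OF f] linear_0[OF f] algebra_simps)
    then show ?thesis
      using K by (auto simp: convex_cone_iff)
  qed
  ultimately have "convex_cone hull P \<subseteq> {p. B p q \<in> K}" if "q \<in> Q" for q
    using that by (auto simp: convex_cone_hull_subset_iff)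
  moreover have "convex_cone {q. B p q \<in> K}" for p
  proof -
    have "B p (x + y) = B p x + B p y" "B p (c *\<^sub>R x) = c *\<^sub>R B p x" "B p 0 = 0" for x y c
      by (simp_all add: B_def linear_add[OF f] linear_scale[OF f] linear_0[OF f] algebra_simps)
    then show ?thesis
      using K by (auto simp: convex_cone_iff)
  qed
  ultimately have "convex_cone hull Q \<subseteq> {q. B p q \<in> K}" if "p \<in> convex_cone hull P" for p
    using that by (auto simp: convex_cone_hull_subset_iff)
  then have BK: "B p q \<in> K" if "p \<in> convex_cone hull P" "q \<in> convex_cone hull Q" for p q
    using that by blast
  have "K \<subseteq> {x \<in> convex_cone hull G. 0 \<le> f x}"
  proof -
    have "B p q \<in> convex_cone hull G" if "p \<in> P" "q \<in> Q" for p q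
    proof -
      have "f p *\<^sub>R q + (- f q) *\<^sub>R p \<in> convex_cone hull G"
        using that by (intro convex_cone_hull_add convex_cone_hull_mul hull_inc)
          (auto simp: P_def Q_def)
      then show ?thesis by (simp add: B_def)
    qed
    moreover have "P \<subseteq> convex_cone hull G"
      by (auto simp: P_def hull_inc)
    moreover have "convex_cone (convex_cone hull G \<inter> {x. 0 \<le> f x})"
      by (intro convex_cone_Int convex_cone_convex_cone_hull linear_halfspace_convex_cone f)
    ultimately have "K \<subseteq> convex_cone hull G \<inter> {x. 0 \<le> f x}"
      unfolding K_def by (subst convex_cone_hull_subset_iff) (auto simp: fB P_def)
    then show ?thesis by blast
  qed
  moreover have "x \<in> K" if x: "x \<in> convex_cone hull G" "0 \<le> f x" for x
  proof -
    have "G = P \<union> Q"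
      by (auto simp: P_def Q_def)
    with x obtain p q where pq: "p \<in> convex_cone hull P" "q \<in> convex_cone hull Q" "x = p + q"
      by (metis convex_cone_hull_UnE)
    show ?thesis
    proof (cases "f p = 0")
      \<comment> \<open>Here \<open>f q\<close> is nonnegative, whereas every nonzero element of
        \<open>convex_cone hull Q\<close> has a negative value under \<open>f\<close>.\<close>
      case True
      have "q = 0"
      proof -
        have "convex_cone {q. q = 0 \<or> f q < 0}"
          by (auto simp: convex_cone_iff linear_add[OF f] linear_scale[OF f] linear_0[OF f] mult_pos_neg)
        then have "convex_cone hull Q \<subseteq> {q. q = 0 \<or> f q < 0}"
          by (auto simp: convex_cone_hull_subset_iff Q_def)
        moreover have "f q \<ge> 0"
          using x(2) pq(3) True by (simp add: linear_add[OF f])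
        ultimately show ?thesis
          using pq(2) by force
      qed
      then show ?thesis
        using pq PK by auto
    next
      case False
      then have fp: "f p > 0"
        using nonneg[OF pq(1)] by simp
      \<comment> \<open>The first term equals \<open>q - (f q / f p) *\<^sub>R p\<close>; the second
        restores the missing multiple of \<open>p\<close>, with coefficient
        \<open>f x / f p\<close>.\<close>
      have "x = (1 / f p) *\<^sub>R B p q + (1 + f q / f p) *\<^sub>R p"
        using fp by (simp add: pq(3) B_def algebra_simps)
      moreover have "0 \<le> 1 + f q / f p"
        using fp x(2) by (simp add: pq(3) linear_add[OF f] field_simps)
      ultimately show ?thesis
        using BK[OF pq(1,2)] PK pq(1) fp
        by (auto intro!: convex_cone_add[OF K] convex_cone_scaleR[OF K])
    qed
  qed
  ultimately have "K = {x \<in> convex_cone hull G. 0 \<le> f x}"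
    by blast
  moreover have "finite (P \<union> (\<lambda>(p, q). B p q) ` (P \<times> Q))"
    using G by (auto simp: P_def Q_def)
  ultimately show ?thesis
    unfolding K_def by blast
qed

lemma finitely_generated_Int_halfspaces:
  fixes F :: "('a::real_vector \<Rightarrow> real) set"
  assumes "finite F" "\<And>f. f \<in> F \<Longrightarrow> linear f" "finite G"
  shows "\<exists>G'. finite G' \<and> convex_cone hull G' = {x \<in> convex_cone hull G. \<forall>f\<in>F. 0 \<le> f x}"
  using assms(1,2)
proof (induction F rule: finite_induct)
  case empty
  then show ?case using assms(3) by auto
next
  case (insert f F)
  then obtain G' where G': "finite G'"
      "convex_cone hull G' = {x \<in> convex_cone hull G. \<forall>f\<in>F. 0 \<le> f x}"
    by auto
  obtain G'' where G'': "finite G''"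
      "convex_cone hull G'' = {x \<in> convex_cone hull G'. 0 \<le> f x}"
    using finitely_generated_Int_halfspace[of f G'] insert.prems G'(1) by auto
  show ?case
    by (rule exI[of _ G'']) (use G' G'' in auto)
qed


section \<open>Extreme rays of pointed finitely generated cones\<close>

lemma extreme_raysE:
  assumes "r \<in> extreme_rays C"
  obtains x where "x \<noteq> 0" "r = conic hull {x}" "r face_of C"
  using assms by (auto simp: extreme_rays_def)

lemma extreme_rays_halfline: "r \<in> extreme_rays C \<Longrightarrow> \<exists>x. r = conic hull {x}"
  by (blast elim: extreme_raysE)

text \<open>Halving turns a sum into a midpoint, so the open-segment definition of a face also
  governs sums in a cone. The case \<open>a = b\<close> is separate because its open segment is
  empty.\<close>

lemma face_of_conic_addD:
  assumes "r face_of C" "conic r" "conic C" "a \<in> C" "b \<in> C" "a + b \<in> r"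
  shows "a \<in> r"
proof (cases "a = b")
  case True
  then have "a = (1/2) *\<^sub>R (a + b)"
    by (simp flip: scaleR_2)
  then show ?thesis
    using conic_mul[OF assms(2,6), of "1/2"] by simp
next
  case False
  then have "(1/2) *\<^sub>R (a + b) \<in> open_segment a b"
    by (auto simp: in_segment scaleR_add_right intro!: exI[of _ "1/2"])
  moreover have "(1/2) *\<^sub>R (a + b) \<in> r"
    using conic_mul[OF assms(2,6), of "1/2"] by simp
  ultimately show ?thesis
    using face_ofD assms(1,4,5) by blast
qed

text \<open>A face absorbs both summands of any sum it contains, so a nonzero point of
  \<open>r\<close> can be generated only with a nonzero generator on \<open>r\<close>, and that
  generator spans \<open>r\<close>. The union of \<open>R\<close> is merely contained in
  \<open>C\<close>, so that the lemma also applies to \<open>R - {r}\<close>.\<close>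

lemma extreme_ray_in_generators:
  assumes "x \<in> convex_cone hull (\<Union>R)" "x \<in> r" "x \<noteq> 0"
    and R: "\<And>s. s \<in> R \<Longrightarrow> \<exists>y. s = conic hull {y}"
    and r: "r = conic hull {z}" "r face_of C"
    and C: "convex_cone C" "\<Union>R \<subseteq> C"
  shows "r \<in> R"
proof -
  have conic: "conic r" "conic C"
    using r C by (simp_all add: conic_conic_hull convex_cone_def)
  have "\<Union>R \<subseteq> {y \<in> C. y \<in> r \<longrightarrow> y \<noteq> 0 \<longrightarrow> r \<in> R}"
  proof safe
    fix y s assume y: "y \<in> s" "s \<in> R" "y \<in> r" "y \<noteq> 0"
    then obtain g where "s = conic hull {g}"
      using R by blast
    then have "s = r"
      using y r(1) conic_hull_singleton_eqI by metis
    then show "r \<in> R"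
      using y by simp
  qed (use C(2) in blast)
  moreover have "convex_cone {y \<in> C. y \<in> r \<longrightarrow> y \<noteq> 0 \<longrightarrow> r \<in> R}"
    unfolding convex_cone_iff
  proof (intro conjI ballI allI impI)
    fix x y assume xy: "x \<in> {y \<in> C. y \<in> r \<longrightarrow> y \<noteq> 0 \<longrightarrow> r \<in> R}"
      "y \<in> {y \<in> C. y \<in> r \<longrightarrow> y \<noteq> 0 \<longrightarrow> r \<in> R}"
    then have "x \<in> r" "y \<in> r" if "x + y \<in> r"
      using that face_of_conic_addD[OF r(2) conic, of x y] face_of_conic_addD[OF r(2) conic, of y x]
      by (simp_all add: add.commute[of x y])
    then show "x + y \<in> {y \<in> C. y \<in> r \<longrightarrow> y \<noteq> 0 \<longrightarrow> r \<in> R}"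
      using xy convex_cone_add[OF C(1)] by auto
  next
    fix x and c :: real assume x: "x \<in> {y \<in> C. y \<in> r \<longrightarrow> y \<noteq> 0 \<longrightarrow> r \<in> R}" "0 \<le> c"
    have "x \<in> r" if "c *\<^sub>R x \<in> r" "c \<noteq> 0"
      using conic_mul[OF conic(1) that(1), of "1 / c"] that(2) x(2) by simp
    then show "c *\<^sub>R x \<in> {y \<in> C. y \<in> r \<longrightarrow> y \<noteq> 0 \<longrightarrow> r \<in> R}"
      using x convex_cone_scaleR[OF C(1)] by auto
  qed (use convex_cone_contains_0[OF C(1)] in auto)
  ultimately have "convex_cone hull (\<Union>R) \<subseteq> {y \<in> C. y \<in> r \<longrightarrow> y \<noteq> 0 \<longrightarrow> r \<in> R}"
    by (simp add: convex_cone_hull_subset_iff)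
  then show ?thesis
    using assms(1-3) by blast
qed

text \<open>Extreme rays survive because they occur in every generating family. Conversely, points
  of \<open>C\<close> split into a multiple of \<open>x\<close> and a part generated by the other
  rays; pointedness makes the second part vanish at the ends of any segment whose interior meets an
  irredundant ray.\<close>

lemma remove_redundant_eq_extreme_rays:
  assumes R: "\<And>s. s \<in> R \<Longrightarrow> \<exists>y. s = conic hull {y}"
    and C: "C = convex_cone hull (\<Union>R)"
    and pointed: "\<And>x. x \<in> C \<Longrightarrow> - x \<in> C \<Longrightarrow> x = 0"
  shows "remove_redundant R = extreme_rays C"
proof (intro equalityI subsetI)
  have cone: "convex_cone C"
    by (simp add: C convex_cone_convex_cone_hull)
  have RC: "\<Union>R \<subseteq> C"
    by (simp add: C hull_subset)
  {
    fix r assume "r \<in> extreme_rays C"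
    then obtain x where x: "x \<noteq> 0" "r = conic hull {x}" "r face_of C"
      by (rule extreme_raysE)
    have xr: "x \<in> r"
      by (simp add: x(2) hull_inc)
    then have "x \<in> C"
      using face_of_imp_subset[OF x(3)] by blast
    then have "r \<in> R"
      using extreme_ray_in_generators[OF _ xr x(1) R x(2,3) cone RC] C by blast
    moreover have "\<not> redundant R r"
    proof
      assume "redundant R r"
      then have "x \<in> convex_cone hull (\<Union>(R - {r}))"
        using xr by (auto simp: redundant_def)
      then have "r \<in> R - {r}"
        by (rule extreme_ray_in_generators[OF _ xr x(1) _ x(2,3) cone]) (use R RC in auto)
      then show False by simp
    qed
    ultimately show "r \<in> remove_redundant R"
      by (simp add: remove_redundant_def)
  next
    fix r assume "r \<in> remove_redundant R"
    then have r: "r \<in> R" "\<not> r \<subseteq> convex_cone hull (\<Union>(R - {r}))"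
      by (auto simp: remove_redundant_def redundant_def)
    define D where "D = convex_cone hull (\<Union>(R - {r}))"
    have D: "convex_cone D"
      by (simp add: D_def convex_cone_convex_cone_hull)
    have DC: "D \<subseteq> C"
      unfolding D_def C by (rule hull_mono) blast
    obtain x where x: "r = conic hull {x}"
      using R r(1) by blast
    have xD: "x \<notin> D"
    proof
      assume "x \<in> D"
      then have "r \<subseteq> D"
        unfolding x using D by (simp add: convex_cone_def subset_hull)
      with r(2) show False by (simp add: D_def)
    qed
    then have "x \<noteq> 0"
      using convex_cone_contains_0[OF D] by auto
    have split: "\<exists>c d. 0 \<le> c \<and> d \<in> D \<and> a = c *\<^sub>R x + d" if "a \<in> C" for a
    proof -
      have "a \<in> convex_cone hull (r \<union> \<Union>(R - {r}))"
        using that r(1) unfolding C by (metis Union_insert insert_Diff)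
      then obtain y d where "y \<in> convex_cone hull r" "d \<in> D" "a = y + d"
        unfolding D_def by (rule convex_cone_hull_UnE)
      then show ?thesis
        using hull_same[of convex_cone r] convex_cone_conic_hull_singleton[of x] x
        by (auto simp: mem_conic_hull_singleton)
    qed
    have "r face_of C"
      unfolding face_of_def
    proof (intro conjI ballI impI)
      show "r \<subseteq> C" using r(1) RC by blast
      show "convex r" by (simp add: x convex_conic_hull)
      fix a b p assume ab: "a \<in> C" "b \<in> C" and p: "p \<in> r" "p \<in> open_segment a b"
      obtain c d c' d' where cd: "0 \<le> c" "d \<in> D" "a = c *\<^sub>R x + d"
          "0 \<le> c'" "d' \<in> D" "b = c' *\<^sub>R x + d'"
        using split[OF ab(1)] split[OF ab(2)] by blast
      obtain u where u: "0 < u" "u < 1" "p = (1 - u) *\<^sub>R a + u *\<^sub>R b"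
        using p(2) by (auto simp: in_segment)
      obtain e where e: "e \<ge> 0" "p = e *\<^sub>R x"
        using p(1) by (auto simp: x mem_conic_hull_singleton)
      define q where "q = (1 - u) *\<^sub>R d + u *\<^sub>R d'"
      \<comment> \<open>\<open>k\<close> is the multiple of \<open>x\<close> left once the multiples
        of \<open>x\<close> in \<open>a\<close> and \<open>b\<close> are removed from
        \<open>p\<close>.\<close>
      define k where "k = e - ((1 - u) * c + u * c')"
      have q: "q = k *\<^sub>R x"
        using u(3) e(2) by (simp add: q_def k_def cd algebra_simps)
      have parts: "(1 - u) *\<^sub>R d \<in> D" "u *\<^sub>R d' \<in> D"
        using cd u D by (simp_all add: convex_cone_scaleR)
      then have qD: "q \<in> D"
        by (simp add: q_def convex_cone_add[OF D])
      \<comment> \<open>A positive \<open>k\<close> would put \<open>x\<close> in \<open>D\<close>;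
        a nonpositive one puts both \<open>q\<close> and \<open>- q\<close> in \<open>C\<close>, so
        \<open>q = 0\<close> by pointedness.\<close>
      have "k \<le> 0"
      proof (rule ccontr)
        assume "\<not> k \<le> 0"
        then have "x = (1 / k) *\<^sub>R q" "0 \<le> 1 / k"
          by (simp_all add: q)
        then show False
          using xD convex_cone_scaleR[OF D _ qD] by metis
      qed
      have xC: "x \<in> C"
        using r(1) RC x hull_inc[of x "{x}" conic] by blast
      have "- q = (- k) *\<^sub>R x"
        by (simp add: q)
      then have "- q \<in> C"
        using convex_cone_scaleR[OF cone _ xC, of "- k"] \<open>k \<le> 0\<close> by simp
      then have "q = 0"
        using pointed qD DC by blast
      \<comment> \<open>Pointedness is used again: two elements of \<open>D\<close> that cancel are
        both zero, so \<open>a\<close> and \<open>b\<close> are multiples of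
        \<open>x\<close>.\<close>
      then have neg: "u *\<^sub>R d' = - ((1 - u) *\<^sub>R d)"
        by (simp add: q_def eq_neg_iff_add_eq_0 add.commute)
      then have "(1 - u) *\<^sub>R d = 0"
        using pointed parts DC by (metis subsetD)
      then have "d = 0" "d' = 0"
        using neg u by auto
      then show "a \<in> r" "b \<in> r"
        using cd by (auto simp: x mem_conic_hull_singleton)
    qed
    then show "r \<in> extreme_rays C"
      using x \<open>x \<noteq> 0\<close> by (auto simp: extreme_rays_def)
  }
qed

text \<open>
  Simultaneous removal of all redundant rays loses nothing: in a pointed cone every inclusion-minimal
  generating subset of \<open>R\<close> is the set of extreme rays.
\<close>

lemma V_description_extreme_rays:
  assumes fin: "finite R" and R: "\<And>s. s \<in> R \<Longrightarrow> \<exists>y. s = conic hull {y}"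
    and C: "C = convex_cone hull (\<Union>R)"
    and pointed: "\<And>x. x \<in> C \<Longrightarrow> - x \<in> C \<Longrightarrow> x = 0"
  shows "V_description (extreme_rays C) C"
proof -
  define gen where "gen T \<longleftrightarrow> T \<subseteq> R \<and> convex_cone hull (\<Union>T) = C" for T
  have "gen R"
    by (simp add: gen_def C)
  moreover have "finite {T. gen T}"
    by (rule finite_subset[of _ "Pow R"]) (auto simp: gen_def fin)
  ultimately obtain T where T: "gen T" "\<And>U. gen U \<Longrightarrow> U \<subseteq> T \<Longrightarrow> U = T"
    using finite_has_minimal[of "{T. gen T}"] by blast
  \<comment> \<open>A redundant ray could be dropped without changing the hull, against the
    minimality of \<open>T\<close>.\<close>
  have "\<not> redundant T r" for r
  proof
    assume "redundant T r"
    then have r: "r \<in> T" "r \<subseteq> convex_cone hull (\<Union>(T - {r}))"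
      by (auto simp: redundant_def)
    have "\<Union>T \<subseteq> convex_cone hull (\<Union>(T - {r}))"
    proof
      fix x assume "x \<in> \<Union>T"
      then show "x \<in> convex_cone hull (\<Union>(T - {r}))"
        using r(2) hull_inc[of x "\<Union>(T - {r})" convex_cone] by blast
    qed
    then have "convex_cone hull (\<Union>T) \<subseteq> convex_cone hull (\<Union>(T - {r}))"
      by (simp add: convex_cone_hull_subset_iff convex_cone_convex_cone_hull)
    moreover have "convex_cone hull (\<Union>(T - {r})) \<subseteq> convex_cone hull (\<Union>T)"
      by (rule hull_mono) blast
    ultimately have "gen (T - {r})"
      using T(1) by (auto simp: gen_def)
    then have "T - {r} = T"
      using T(2) by blast
    with r(1) show False by blast
  qed
  moreover have "remove_redundant T = extreme_rays C"
    using T(1) R pointed by (intro remove_redundant_eq_extreme_rays) (auto simp: gen_def)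
  ultimately show ?thesis
    using T(1) finite_subset[OF _ fin]
    by (auto simp: V_description_def remove_redundant_def gen_def)
qed

text \<open>Each generator is replaced by its half-line; a zero generator contributes
  \<open>{0}\<close>, which the ray hypothesis permits.\<close>

lemma V_description_finitely_generated:
  assumes "finite G" "C = convex_cone hull G" "\<And>x. x \<in> C \<Longrightarrow> - x \<in> C \<Longrightarrow> x = 0"
  shows "V_description (extreme_rays C) C"
proof (rule V_description_extreme_rays)
  let ?R = "(\<lambda>x. conic hull {x}) ` G"
  have "\<Union>?R \<subseteq> convex_cone hull G"
    by (auto simp: mem_conic_hull_singleton convex_cone_hull_mul hull_inc)
  moreover have "G \<subseteq> \<Union>?R"
    by (auto intro: hull_inc)
  ultimately show "C = convex_cone hull (\<Union>?R)"
    unfolding assms(2)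
    by (meson convex_cone_convex_cone_hull convex_cone_hull_subset_iff hull_mono subset_antisym)
qed (use assms in auto)


section \<open>Cut weights and realizations\<close>

lemma scaleR_fun_apply [simp]: "(c *\<^sub>R f) x = c *\<^sub>R f x"
  by (simp add: scaleR_fun_def)

lemma unit_vec_apply [simp]: "unit_vec i j = (if j = i then 1 else 0)"
  by (simp add: unit_vec_def)

lemma finite_edges [simp]: "finite (edges N)"
  by (rule finite_subset[of _ "{1..N} \<times> {1..N}"]) (auto simp: edges_def)

lemma finite_terminal_sets [simp]: "finite (terminal_sets n)"
  by (rule finite_subset[of _ "Pow {1..n}"]) (auto simp: terminal_sets_def)

lemma terminal_sets_subset:
  assumes "I \<in> terminal_sets n" "n < N"
  shows "I \<subseteq> {1..N - 1} \<and> I \<inter> {1..n} = I"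
proof -
  have "I \<subseteq> {1..n}" "{1..n} \<subseteq> {1..N - 1}"
    using assms by (auto simp: terminal_sets_def)
  then show ?thesis by blast
qed

lemma cut_subset_edges: "cut N W \<subseteq> edges N"
  by (auto simp: cut_def)

lemma finite_cut [simp]: "finite (cut N W)"
  by (rule finite_subset[OF cut_subset_edges finite_edges])

lemma cut_weight_add: "cut_weight N (v + w) W = cut_weight N v W + cut_weight N w W"
  by (simp add: cut_weight_def sum.distrib)

lemma cut_weight_scaleR: "cut_weight N (c *\<^sub>R w) W = c * cut_weight N w W"
  by (simp add: cut_weight_def sum_distrib_left)

lemma cut_weight_zero [simp]: "cut_weight N 0 W = 0"
  by (simp add: cut_weight_def)

lemma cut_weight_nonneg: "(\<And>e. e \<in> edges N \<Longrightarrow> 0 \<le> w e) \<Longrightarrow> 0 \<le> cut_weight N w W"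
  unfolding cut_weight_def by (rule sum_nonneg) (use cut_subset_edges in blast)

lemma subspace_vecs: "subspace (vecs A)"
  by (auto simp: subspace_def vecs_def)

lemma vecs_outside: "f \<in> vecs A \<Longrightarrow> x \<notin> A \<Longrightarrow> f x = 0"
  by (simp add: vecs_def)

lemma mem_P_cone:
  "(S, w) \<in> P_cone N n \<longleftrightarrow>
    S \<in> vecs (terminal_sets n) \<and> w \<in> vecs (edges N) \<and>
    (\<forall>W. W \<subseteq> {1..N - 1} \<and> W \<inter> {1..n} \<noteq> {} \<longrightarrow> S (W \<inter> {1..n}) \<le> cut_weight N w W) \<and>
    (\<forall>e\<in>edges N. 0 \<le> w e)"
  by (auto simp: P_cone_def terminal_sets_def)

lemma P_cone_scaleR:
  assumes "(S, w) \<in> P_cone N n" "0 \<le> c"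
  shows "(c *\<^sub>R S, c *\<^sub>R w) \<in> P_cone N n"
  using assms
  by (simp add: mem_P_cone cut_weight_scaleR subspace_scale[OF subspace_vecs] mult_left_mono)

text \<open>Minimum cuts become tight inequalities: a realization is a point of
  \<open>P_cone\<close> at which, for each \<open>I\<close>, some cut inequality is tight.\<close>

lemma realizes_iff:
  "realizes n N w S \<longleftrightarrow> n < N \<and> (S, w) \<in> P_cone N n \<and>
    (\<forall>I\<in>terminal_sets n. \<exists>W. W \<subseteq> {1..N - 1} \<and> W \<inter> {1..n} = I \<and> S I = cut_weight N w W)"
proof -
  have "S I = Min {cut_weight N w W |W. W \<subseteq> {1..N - 1} \<and> W \<inter> {1..n} = I} \<longleftrightarrow>
      (\<exists>W. W \<subseteq> {1..N - 1} \<and> W \<inter> {1..n} = I \<and> S I = cut_weight N w W) \<and>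
      (\<forall>W. W \<subseteq> {1..N - 1} \<and> W \<inter> {1..n} = I \<longrightarrow> S I \<le> cut_weight N w W)"
    if "n < N" "I \<in> terminal_sets n" for I
  proof -
    let ?A = "{cut_weight N w W |W. W \<subseteq> {1..N - 1} \<and> W \<inter> {1..n} = I}"
    have "finite ?A"
      by (rule finite_subset[of _ "cut_weight N w ` Pow {1..N - 1}"]) auto
    moreover have "cut_weight N w I \<in> ?A"
      using terminal_sets_subset[OF that(2,1)] by blast
    then have "?A \<noteq> {}"
      by blast
    ultimately have "S I = Min ?A \<longleftrightarrow> S I \<in> ?A \<and> (\<forall>x\<in>?A. S I \<le> x)"
      by (rule eq_Min_iff)
    then show ?thesis by blast
  qed
  then have 1: "(\<forall>I\<in>terminal_sets n.
        S I = Min {cut_weight N w W |W. W \<subseteq> {1..N - 1} \<and> W \<inter> {1..n} = I}) \<longleftrightarrow>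
      (\<forall>I\<in>terminal_sets n. \<exists>W. W \<subseteq> {1..N - 1} \<and> W \<inter> {1..n} = I \<and> S I = cut_weight N w W) \<and>
      (\<forall>I\<in>terminal_sets n. \<forall>W. W \<subseteq> {1..N - 1} \<and> W \<inter> {1..n} = I \<longrightarrow> S I \<le> cut_weight N w W)"
    if "n < N"
    using that by (simp add: ball_conj_distrib cong: ball_cong)
  have 2: "(\<forall>I\<in>terminal_sets n. \<forall>W. W \<subseteq> {1..N - 1} \<and> W \<inter> {1..n} = I \<longrightarrow> S I \<le> cut_weight N w W) \<longleftrightarrow>
      (\<forall>W. W \<subseteq> {1..N - 1} \<and> W \<inter> {1..n} \<noteq> {} \<longrightarrow> S (W \<inter> {1..n}) \<le> cut_weight N w W)"
    unfolding terminal_sets_def by blast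
  show ?thesis
  proof (cases "n < N")
    case True
    show ?thesis
      unfolding realizes_def mem_P_cone 1[OF True] 2
      by (intro iffI; elim conjE; intro conjI; assumption)
  qed (simp add: realizes_def)
qed

text \<open>
  An edge with merged endpoints is sent to a pair \<open>(i, i)\<close>, which is not in \<open>edges M\<close>, so
  \<open>push_weight\<close> drops its weight.
\<close>

definition edge_image :: "(nat \<Rightarrow> nat) \<Rightarrow> nat \<times> nat \<Rightarrow> nat \<times> nat"
  where "edge_image \<phi> e =
    (min (\<phi> (fst e)) (\<phi> (snd e)), max (\<phi> (fst e)) (\<phi> (snd e)))"

definition push_weight ::
    "nat \<Rightarrow> nat \<Rightarrow> (nat \<Rightarrow> nat) \<Rightarrow> (nat \<times> nat \<Rightarrow> real) \<Rightarrow> nat \<times> nat \<Rightarrow> real"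
  where "push_weight N M \<phi> w =
    (\<lambda>e'. if e' \<in> edges M then \<Sum>e | e \<in> edges N \<and> edge_image \<phi> e = e'. w e else 0)"

lemma push_weight_vecs: "push_weight N M \<phi> w \<in> vecs (edges M)"
  by (simp add: push_weight_def vecs_def)

lemma push_weight_nonneg:
  "(\<And>e. e \<in> edges N \<Longrightarrow> 0 \<le> w e) \<Longrightarrow> 0 \<le> push_weight N M \<phi> w e'"
  by (auto simp: push_weight_def intro: sum_nonneg)

text \<open>An edge crosses the preimage exactly when its image crosses \<open>W\<close>; collapsed
  edges cross neither, so dropping them loses nothing. The sum is then regrouped by image
  edge.\<close>

lemma cut_weight_push:
  assumes "\<phi> ` {1..N} \<subseteq> {1..M}"
  shows "cut_weight M (push_weight N M \<phi> w) W = cut_weight N w {v \<in> {1..N}. \<phi> v \<in> W}"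
proof -
  let ?V = "{v \<in> {1..N}. \<phi> v \<in> W}"
  have mem: "e \<in> cut N ?V \<longleftrightarrow> edge_image \<phi> e \<in> cut M W" if ed: "e \<in> edges N" for e
  proof -
    obtain i j where e: "e = (i, j)" "1 \<le> i" "i < j" "j \<le> N"
      using ed by (auto simp: edges_def)
    then have "i \<in> {1..N}" "j \<in> {1..N}"
      by auto
    then have "\<phi> i \<in> {1..M}" "\<phi> j \<in> {1..M}"
      using assms by blast+
    then show ?thesis
      using e by (cases "\<phi> i" "\<phi> j" rule: linorder_cases)
        (auto simp: cut_def edges_def edge_image_def min_def max_def)
  qed
  have "cut_weight M (push_weight N M \<phi> w) W =
      (\<Sum>e'\<in>cut M W. \<Sum>e | e \<in> edges N \<and> edge_image \<phi> e = e'. w e)"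
    unfolding cut_weight_def push_weight_def
    by (rule sum.cong) (use cut_subset_edges in auto)
  also have "\<dots> = (\<Sum>e'\<in>cut M W. \<Sum>e | e \<in> cut N ?V \<and> edge_image \<phi> e = e'. w e)"
    using mem cut_subset_edges by (intro sum.cong refl) blast
  also have "\<dots> = (\<Sum>e\<in>cut N ?V. w e)"
  proof (rule sum.group)
    show "edge_image \<phi> ` cut N ?V \<subseteq> cut M W"
      using mem cut_subset_edges by blast
  qed simp_all
  finally show ?thesis
    by (simp add: cut_weight_def)
qed

section \<open>Vertex maps respecting the terminals\<close>

text \<open>Vertex \<open>N\<close>, which no admissible cut contains, acts as a sink and must go to
  the sink \<open>M\<close>. Inner vertices stay inner, so images and preimages of admissible cuts
  are admissible with the same trace on \<open>{1..n}\<close>.\<close>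

definition terminal_map :: "nat \<Rightarrow> nat \<Rightarrow> nat \<Rightarrow> (nat \<Rightarrow> nat) \<Rightarrow> bool"
  where "terminal_map n N M \<phi> \<longleftrightarrow>
    (\<forall>i\<in>{1..n}. \<phi> i = i) \<and> (\<forall>i. n < i \<and> i < N \<longrightarrow> n < \<phi> i \<and> \<phi> i < M) \<and> \<phi> N = M"

lemma terminal_map_le:
  assumes "terminal_map n N M \<phi>" "n < N" "n < M"
  shows "\<phi> ` {1..N} \<subseteq> {1..M}"
proof -
  have "1 \<le> \<phi> i \<and> \<phi> i \<le> M" if "i \<in> {1..N}" for i
  proof (cases "i \<le> n")
    case True
    with that assms show ?thesis
      by (auto simp: terminal_map_def)
  next
    case False
    then have "i = N \<or> n < \<phi> i \<and> \<phi> i < M" "\<phi> N = M"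
      using that assms(1) by (auto simp: terminal_map_def)
    then show ?thesis
      using assms(3) by auto
  qed
  then show ?thesis by auto
qed

lemma terminal_map_vimage:
  assumes "terminal_map n N M \<phi>" "n < N" "n < M" "W \<subseteq> {1..M - 1}"
  shows "{v \<in> {1..N}. \<phi> v \<in> W} \<subseteq> {1..N - 1}"
    and "{v \<in> {1..N}. \<phi> v \<in> W} \<inter> {1..n} = W \<inter> {1..n}"
proof -
  have "M \<notin> W"
    using assms(3,4) by auto
  then have "\<phi> N \<notin> W"
    using assms(1) by (simp add: terminal_map_def)
  then have "v \<noteq> N" if "\<phi> v \<in> W" for v
    using that by blast
  then show "{v \<in> {1..N}. \<phi> v \<in> W} \<subseteq> {1..N - 1}"
    by fastforce
  show "{v \<in> {1..N}. \<phi> v \<in> W} \<inter> {1..n} = W \<inter> {1..n}"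
    using assms(1,2) by (auto simp: terminal_map_def)
qed

lemma terminal_map_image:
  assumes "terminal_map n N M \<phi>" "n < N" "n < M" "W \<subseteq> {1..N - 1}"
  shows "\<phi> ` W \<subseteq> {1..M - 1}" and "\<phi> ` W \<inter> {1..n} = W \<inter> {1..n}"
proof -
  have *: "if v \<le> n then \<phi> v = v else n < \<phi> v \<and> \<phi> v < M" if "v \<in> W" for v
    using that assms by (force simp: terminal_map_def)
  show "\<phi> ` W \<subseteq> {1..M - 1}"
  proof
    fix u assume "u \<in> \<phi> ` W"
    then obtain v where "v \<in> W" "u = \<phi> v"
      by blast
    moreover from this have "1 \<le> v"
      using assms(4) by auto
    ultimately show "u \<in> {1..M - 1}"
      using *[of v] assms(3) by (auto split: if_splits)
  qed
  show "\<phi> ` W \<inter> {1..n} = W \<inter> {1..n}"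
  proof (intro equalityI subsetI)
    fix u assume u: "u \<in> \<phi> ` W \<inter> {1..n}"
    then obtain v where "v \<in> W" "u = \<phi> v"
      by blast
    then show "u \<in> W \<inter> {1..n}"
      using *[of v] u by (auto split: if_splits)
  next
    fix u assume "u \<in> W \<inter> {1..n}"
    then show "u \<in> \<phi> ` W \<inter> {1..n}"
      using *[of u] by (force intro: rev_image_eqI)
  qed
qed

text \<open>Every cut after pushing weighs as much as its preimage, which has the same trace on the
  terminals, so the old inequality applies.\<close>

lemma push_weight_mem_P_cone:
  assumes "terminal_map n N M \<phi>" "n < N" "n < M" "(S, w) \<in> P_cone N n"
  shows "(S, push_weight N M \<phi> w) \<in> P_cone M n"
  unfolding mem_P_cone
proof (intro conjI allI impI ballI)
  fix W assume W: "W \<subseteq> {1..M - 1} \<and> W \<inter> {1..n} \<noteq> {}"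
  then have "W \<subseteq> {1..M - 1}" by simp
  note V = terminal_map_vimage[OF assms(1-3) this]
  have "S (W \<inter> {1..n}) \<le> cut_weight N w {v \<in> {1..N}. \<phi> v \<in> W}"
    using assms(4) V W unfolding mem_P_cone by metis
  then show "S (W \<inter> {1..n}) \<le> cut_weight M (push_weight N M \<phi> w) W"
    by (subst cut_weight_push[OF terminal_map_le[OF assms(1-3)]])
qed (use assms(4) in \<open>auto simp: mem_P_cone push_weight_vecs push_weight_nonneg\<close>)

text \<open>
  Choose one minimum cut for every \<open>I\<close> and merge the vertices lying on the same side of all of
  them; the number of classes is bounded in terms of \<open>n\<close> alone.
\<close>

lemma realizes_bounded:
  assumes "realizes n N w S"
  shows "\<exists>w'. realizes n (n + 1 + card (Pow (terminal_sets n))) w' S"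
proof -
  define M where "M = n + 1 + card (Pow (terminal_sets n))"
  have nN: "n < N" and P: "(S, w) \<in> P_cone N n"
    using assms by (auto simp: realizes_iff)
  obtain V where V: "\<And>I. I \<in> terminal_sets n \<Longrightarrow>
      V I \<subseteq> {1..N - 1} \<and> V I \<inter> {1..n} = I \<and> S I = cut_weight N w (V I)"
    using assms unfolding realizes_iff by metis
  obtain h where h: "bij_betw h (Pow (terminal_sets n)) {0..<card (Pow (terminal_sets n))}"
    using ex_bij_betw_finite_nat[of "Pow (terminal_sets n)"] by auto
  define side where "side v = {I \<in> terminal_sets n. v \<in> V I}" for v
  \<comment> \<open>Inner vertices land in \<open>n + 1, ..., M - 1\<close>, with one slot for each
    possible \<open>side\<close>; \<open>h\<close> numbers the slots from 0.\<close>
  define \<phi> where "\<phi> v = (if v \<le> n then v else if v = N then M else n + 1 + h (side v))" for v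
  have hlt: "h (side v) < card (Pow (terminal_sets n))" for v
    using bij_betwE[OF h] by (auto simp: side_def)
  have nM: "n < M"
    by (simp add: M_def)
  have \<phi>: "terminal_map n N M \<phi>"
    using nN hlt by (auto simp: terminal_map_def \<phi>_def M_def)
  have "\<exists>W. W \<subseteq> {1..M - 1} \<and> W \<inter> {1..n} = I \<and>
      S I = cut_weight M (push_weight N M \<phi> w) W" if I: "I \<in> terminal_sets n" for I
  proof (intro exI conjI)
    have VI: "V I \<subseteq> {1..N - 1}" "V I \<inter> {1..n} = I"
      using V[OF I] by auto
    show "\<phi> ` V I \<subseteq> {1..M - 1}" "\<phi> ` V I \<inter> {1..n} = I"
      using terminal_map_image[OF \<phi> nN nM VI(1)] VI(2) by auto
    \<comment> \<open>Only vertices of \<open>V I\<close> share an image with a vertex of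
      \<open>V I\<close>, so its image pulls back to \<open>V I\<close> itself and keeps the weight
      \<open>S I\<close>.\<close>
    have "v \<in> V I" if v: "v \<in> {1..N}" "\<phi> v = \<phi> u" and u: "u \<in> V I" for u v
    proof (cases "u \<le> n")
      case True
      then have "v = u"
        using v nN by (auto simp: \<phi>_def M_def split: if_splits)
      with u show ?thesis by simp
    next
      case False
      have "u \<noteq> N"
        using u VI(1) nN by auto
      then have "h (side v) = h (side u)"
        using v False hlt[of u] by (auto simp: \<phi>_def M_def split: if_splits)
      then have "side v = side u"
        using h by (auto simp: bij_betw_def side_def inj_on_def)
      then show ?thesis
        using u I by (auto simp: side_def)
    qed
    moreover have "V I \<subseteq> {1..N}"
      using VI(1) by (rule subset_trans) auto
    ultimately have "{v \<in> {1..N}. \<phi> v \<in> \<phi> ` V I} = V I"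
      by blast
    then show "S I = cut_weight M (push_weight N M \<phi> w) (\<phi> ` V I)"
      using V[OF I] by (simp add: cut_weight_push[OF terminal_map_le[OF \<phi> nN nM]])
  qed
  then have "realizes n M (push_weight N M \<phi> w) S"
    using nM push_weight_mem_P_cone[OF \<phi> nN nM P] by (simp add: realizes_iff)
  then show ?thesis
    unfolding M_def by blast
qed

section \<open>Existence of \<open>m_min\<close> and the cone structure of
  \<open>H_cone\<close>\<close>

lemma realizes_zero:
  assumes "n < N"
  shows "realizes n N 0 0"
proof -
  have "\<exists>W. W \<subseteq> {1..N - 1} \<and> W \<inter> {1..n} = I \<and> 0 I = cut_weight N 0 W"
    if "I \<in> terminal_sets n" for I
    using terminal_sets_subset[OF that assms] by (intro exI[of _ I]) simp
  then show ?thesis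
    using assms by (simp add: realizes_iff mem_P_cone subspace_0[OF subspace_vecs])
qed

lemma zero_mem_H_cone: "0 \<in> H_cone n"
  using realizes_zero[of n "n + 1"] by (auto simp: H_cone_def)

text \<open>\<open>realizes_bounded\<close> gives one size that works for all of
  \<open>H_cone n\<close>, so the \<open>LEAST\<close> in \<open>m_min\<close> is attained.\<close>

lemma realizes_m_min:
  assumes "S \<in> H_cone n"
  shows "\<exists>w. realizes n (m_min n) w S"
proof -
  have "\<forall>S\<in>H_cone n. \<exists>w. realizes n (m_min n) w S"
    unfolding m_min_def
    by (rule LeastI[of "\<lambda>N. \<forall>S\<in>H_cone n. \<exists>w. realizes n N w S"])
      (auto simp: H_cone_def dest: realizes_bounded)
  then show ?thesis
    using assms by blast
qed

text \<open>\<open>realizes\<close> includes \<open>n < N\<close>, so realizing one vector, here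
  zero, on \<open>m_min n\<close> vertices gives the bound.\<close>

lemma m_min_gt: "n < m_min n"
  using realizes_m_min[OF zero_mem_H_cone] by (auto simp: realizes_iff)

text \<open>
  Adding weights on the same graph does not add minimum cuts. Instead two networks are glued along
  the terminals, with disjoint sets of inner vertices.
\<close>

lemma H_cone_add:
  assumes "S \<in> H_cone n" "T \<in> H_cone n"
  shows "S + T \<in> H_cone n"
proof -
  define N where "N = m_min n"
  define M where "M = 2 * N"
  have nN: "n < N" and nM: "n < M"
    using m_min_gt[of n] by (simp_all add: N_def M_def)
  obtain v w where v: "realizes n N v S" and w: "realizes n N w T"
    using assms realizes_m_min unfolding N_def by metis
  \<comment> \<open>\<open>\<phi>\<close> moves only the sink; \<open>\<psi>\<close> shifts inner
    vertices by \<open>N\<close>, beyond those of the first network, and also sends the sink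
    \<open>N\<close> to \<open>M = 2 * N\<close>.\<close>
  define \<phi> where "\<phi> i = (if i = N then M else i)" for i :: nat
  define \<psi> where "\<psi> i = (if i \<le> n then i else i + N)" for i :: nat
  have \<phi>: "terminal_map n N M \<phi>" and \<psi>: "terminal_map n N M \<psi>"
    using nN by (auto simp: terminal_map_def \<phi>_def \<psi>_def M_def)
  define u where "u = push_weight N M \<phi> v + push_weight N M \<psi> w"
  have u: "cut_weight M u W = cut_weight N v {i \<in> {1..N}. \<phi> i \<in> W} +
      cut_weight N w {i \<in> {1..N}. \<psi> i \<in> W}"
    for W
    using terminal_map_le[OF \<phi> nN nM] terminal_map_le[OF \<psi> nN nM]
    by (simp add: u_def cut_weight_add cut_weight_push)
  have "(S, push_weight N M \<phi> v) \<in> P_cone M n" "(T, push_weight N M \<psi> w) \<in> P_cone M n"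
    using v w nN nM \<phi> \<psi> by (auto simp: realizes_iff intro: push_weight_mem_P_cone)
  then have "(S + T, u) \<in> P_cone M n"
    by (auto simp: mem_P_cone u_def cut_weight_add subspace_add[OF subspace_vecs] add_mono)
  moreover have "\<exists>W. W \<subseteq> {1..M - 1} \<and> W \<inter> {1..n} = I \<and> (S + T) I = cut_weight M u W"
    if I: "I \<in> terminal_sets n" for I
  proof -
    obtain A B where A: "A \<subseteq> {1..N - 1}" "A \<inter> {1..n} = I" "S I = cut_weight N v A"
      and B: "B \<subseteq> {1..N - 1}" "B \<inter> {1..n} = I" "T I = cut_weight N w B"
      using v w I unfolding realizes_iff by metis
    define W where "W = \<phi> ` A \<union> \<psi> ` B"
    have W: "W \<subseteq> {1..M - 1}" "W \<inter> {1..n} = I"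
      using terminal_map_image[OF \<phi> nN nM A(1)] terminal_map_image[OF \<psi> nN nM B(1)] A(2) B(2)
      by (auto simp: W_def)
    \<comment> \<open>Cuts with the same trace \<open>I\<close> agree on the terminals, so
      \<open>W\<close> pulls back to exactly \<open>A\<close> along \<open>\<phi>\<close> and to
      exactly \<open>B\<close> along \<open>\<psi>\<close>.\<close>
    have low: "j \<in> A \<longleftrightarrow> j \<in> B" if "j \<le> n" for j
    proof -
      have "j \<in> A \<longleftrightarrow> j \<in> I" "j \<in> B \<longleftrightarrow> j \<in> I"
        using that A(1,2) B(1,2) by (cases "j = 0"; fastforce)+
      then show ?thesis by simp
    qed
    have bounds: "1 \<le> j \<and> j < N" if "j \<in> A \<union> B" for j
    proof -
      have "j \<in> {1..N - 1}"
        using that A(1) B(1) by blast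
      then show ?thesis
        using nN by auto
    qed
    have "i \<in> A" if "i \<in> {1..N}" "\<phi> i = \<phi> j" "j \<in> A" for i j
      using that bounds[of j] nN by (auto simp: \<phi>_def M_def split: if_splits)
    moreover have "i \<in> A" if "i \<in> {1..N}" "\<phi> i = \<psi> j" "j \<in> B" for i j
      using that bounds[of j] low[of j] nN by (auto simp: \<phi>_def \<psi>_def M_def split: if_splits)
    moreover have "A \<subseteq> {1..N}" "B \<subseteq> {1..N}"
      using bounds by force+
    ultimately have VA: "{i \<in> {1..N}. \<phi> i \<in> W} = A"
      by (auto simp: W_def)
    have "i \<in> B" if "i \<in> {1..N}" "\<psi> i = \<psi> j" "j \<in> B" for i j
      using that bounds[of j] nN by (auto simp: \<psi>_def split: if_splits)
    moreover have "i \<in> B" if "i \<in> {1..N}" "\<psi> i = \<phi> j" "j \<in> A" for i j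
      using that bounds[of j] low[of j] nN by (auto simp: \<phi>_def \<psi>_def M_def split: if_splits)
    ultimately have VB: "{i \<in> {1..N}. \<psi> i \<in> W} = B"
      using \<open>B \<subseteq> {1..N}\<close> by (auto simp: W_def)
    show ?thesis
      using W A(3) B(3) by (intro exI[of _ W]) (simp only: plus_fun_apply u VA VB simp_thms)
  qed
  ultimately show ?thesis
    using nM by (auto simp: H_cone_def realizes_iff)
qed

lemma H_cone_scaleR:
  assumes "S \<in> H_cone n" "0 \<le> c"
  shows "c *\<^sub>R S \<in> H_cone n"
proof -
  obtain N w where S: "realizes n N w S"
    using assms(1) by (auto simp: H_cone_def)
  have "\<exists>W. W \<subseteq> {1..N - 1} \<and> W \<inter> {1..n} = I \<and> (c *\<^sub>R S) I = cut_weight N (c *\<^sub>R w) W"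
    if I: "I \<in> terminal_sets n" for I
  proof -
    obtain W where "W \<subseteq> {1..N - 1}" "W \<inter> {1..n} = I" "S I = cut_weight N w W"
      using S I unfolding realizes_iff by metis
    then show ?thesis
      by (intro exI[of _ W]) (simp add: cut_weight_scaleR)
  qed
  moreover have "(c *\<^sub>R S, c *\<^sub>R w) \<in> P_cone N n"
    using S assms(2) by (simp add: realizes_iff P_cone_scaleR)
  ultimately have "realizes n N (c *\<^sub>R w) (c *\<^sub>R S)"
    using S by (simp add: realizes_iff)
  then show ?thesis
    by (auto simp: H_cone_def)
qed

lemma convex_cone_H_cone: "convex_cone (H_cone n)"
  by (simp add: convex_cone_iff zero_mem_H_cone H_cone_add H_cone_scaleR)

text \<open>Minimum cuts under nonnegative weights are nonnegative, so \<open>S\<close> and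
  \<open>- S\<close> can both be realized only when every coordinate is zero.\<close>

lemma H_cone_pointed:
  assumes "S \<in> H_cone n" "- S \<in> H_cone n"
  shows "S = 0"
proof -
  have nonneg: "0 \<le> T I" if T: "T \<in> H_cone n" "I \<in> terminal_sets n" for T I
  proof -
    obtain N w where "realizes n N w T"
      using T(1) by (auto simp: H_cone_def)
    then have "\<exists>W. T I = cut_weight N w W" "\<forall>e\<in>edges N. 0 \<le> w e"
      using T(2) by (auto simp: realizes_iff mem_P_cone)
    then show ?thesis
      by (auto simp: cut_weight_nonneg)
  qed
  have "S I = 0" for I
  proof (cases "I \<in> terminal_sets n")
    case True
    then show ?thesis
      using nonneg[OF assms(1) True] nonneg[OF assms(2) True] by simp
  next
    case False
    then show ?thesis
      using assms(1) by (auto simp: H_cone_def realizes_iff mem_P_cone vecs_def)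
  qed
  then show ?thesis by (simp add: fun_eq_iff)
qed


section \<open>The cone of cut inequalities\<close>

lemma unit_vec_vecs: "i \<in> A \<Longrightarrow> unit_vec i \<in> vecs A"
  by (auto simp: vecs_def)

lemma sum_fun_apply: "(\<Sum>i\<in>A. f i) x = (\<Sum>i\<in>A. f i x)"
  by (induction A rule: infinite_finite_induct) auto

lemma vecs_eq_sum_unit_vec:
  assumes "finite A" "f \<in> vecs A"
  shows "f = (\<Sum>i\<in>A. f i *\<^sub>R unit_vec i)"
proof
  fix x
  have "(\<Sum>i\<in>A. f i *\<^sub>R unit_vec i) x = (\<Sum>i\<in>A. if i = x then f i else 0)"
    unfolding sum_fun_apply by (rule sum.cong) auto
  then show "f x = (\<Sum>i\<in>A. f i *\<^sub>R unit_vec i) x"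
    using assms by (simp add: vecs_def)
qed

lemma linear_cut_slack: "linear (\<lambda>(S, w). cut_weight N w W - S I :: real)"
  by (rule linearI) (auto simp: cut_weight_add cut_weight_scaleR right_diff_distrib)

text \<open>This is the starting cone for the halfspace intersections: \<open>S\<close> has free
  sign, hence both signs of its unit vectors, while \<open>w \<ge> 0\<close> is built in.\<close>

lemma vecs_times_nonneg_finitely_generated:
  assumes "finite A" "finite E"
  shows "convex_cone hull ((\<lambda>i. (unit_vec i, 0)) ` A \<union> (\<lambda>i. (- unit_vec i, 0)) ` A
      \<union> (\<lambda>e. (0, unit_vec e)) ` E)
    = {(S, w). S \<in> vecs A \<and> w \<in> vecs E \<and> (\<forall>e\<in>E. 0 \<le> w e)}" (is "convex_cone hull ?G = ?C")
proof
  have "?G \<subseteq> ?C"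
    by (auto simp: unit_vec_vecs subspace_0[OF subspace_vecs] subspace_neg[OF subspace_vecs])
  moreover have "convex_cone ?C"
    by (auto simp: convex_cone_iff zero_prod_def subspace_0[OF subspace_vecs]
        subspace_add[OF subspace_vecs] subspace_scale[OF subspace_vecs])
  ultimately show "convex_cone hull ?G \<subseteq> ?C"
    by (simp add: convex_cone_hull_subset_iff)
  show "?C \<subseteq> convex_cone hull ?G"
  proof
    fix x assume "x \<in> ?C"
    then obtain S w where x: "x = (S, w)" and S: "S \<in> vecs A" and w: "w \<in> vecs E" "\<forall>e\<in>E. 0 \<le> w e"
      by blast
    have G: "(unit_vec i, 0) \<in> convex_cone hull ?G" "(- unit_vec i, 0) \<in> convex_cone hull ?G"
      if "i \<in> A" for i
      using that by (simp_all add: hull_inc)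
    have "S i *\<^sub>R (unit_vec i, 0) \<in> convex_cone hull ?G" if "i \<in> A" for i
    proof (cases "0 \<le> S i")
      case True
      then show ?thesis
        using G(1)[OF that] by (rule convex_cone_hull_mul[rotated])
    next
      case False
      then have "(- S i) *\<^sub>R (- unit_vec i, 0) \<in> convex_cone hull ?G"
        using G(2)[OF that] by (intro convex_cone_hull_mul) auto
      then show ?thesis by simp
    qed
    moreover have "w e *\<^sub>R (0, unit_vec e) \<in> convex_cone hull ?G" if "e \<in> E" for e
      using that w(2) by (intro convex_cone_hull_mul hull_inc) auto
    ultimately have "(\<Sum>i\<in>A. S i *\<^sub>R (unit_vec i, 0)) + (\<Sum>e\<in>E. w e *\<^sub>R (0, unit_vec e))
        \<in> convex_cone hull ?G"
      by (intro convex_cone_hull_add convex_cone_sum convex_cone_convex_cone_hull)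
    moreover have "(\<Sum>i\<in>A. S i *\<^sub>R (unit_vec i, 0)) + (\<Sum>e\<in>E. w e *\<^sub>R (0, unit_vec e)) = x"
      using vecs_eq_sum_unit_vec[OF assms(1) S] vecs_eq_sum_unit_vec[OF assms(2) w(1)]
      by (simp add: x prod_eq_iff fst_sum snd_sum)
    ultimately show "x \<in> convex_cone hull ?G"
      by simp
  qed
qed

text \<open>Only the cut inequalities remain to be imposed on the starting cone, and there are
  finitely many, one for each \<open>W\<close>.\<close>

lemma P_cone_finitely_generated: "\<exists>G. finite G \<and> P_cone N n = convex_cone hull G"
proof -
  define A where "A = terminal_sets n"
  define E where "E = edges N"
  define G where "G = (\<lambda>i. (unit_vec i, 0)) ` A \<union> (\<lambda>i. (- unit_vec i, 0)) ` A
    \<union> (\<lambda>e. (0, unit_vec e)) ` E"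
  define F where "F = (\<lambda>W (S, w). cut_weight N w W - S (W \<inter> {1..n})) `
    {W. W \<subseteq> {1..N - 1} \<and> W \<inter> {1..n} \<noteq> {}}"
  have "finite G"
    by (simp add: G_def A_def E_def)
  moreover have "finite F"
    unfolding F_def by (rule finite_imageI, rule finite_subset[of _ "Pow {1..N - 1}"]) auto
  moreover have "linear f" if "f \<in> F" for f
    using that by (auto simp: F_def linear_cut_slack)
  ultimately obtain G' where G': "finite G'"
      "convex_cone hull G' = {x \<in> convex_cone hull G. \<forall>f\<in>F. 0 \<le> f x}"
    using finitely_generated_Int_halfspaces[of F G] by blast
  have "convex_cone hull G = {(S, w). S \<in> vecs A \<and> w \<in> vecs E \<and> (\<forall>e\<in>E. 0 \<le> w e)}"
    unfolding G_def by (rule vecs_times_nonneg_finitely_generated) (simp_all add: A_def E_def)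
  then have "x \<in> P_cone N n \<longleftrightarrow> x \<in> convex_cone hull G'" for x
    by (cases x) (auto simp: G'(2) mem_P_cone F_def A_def E_def)
  then show ?thesis
    using G'(1) by blast
qed

text \<open>The sign conditions force \<open>w = 0\<close>, after which every cut weighs zero. As
  \<open>n < N\<close>, the choice \<open>W = I\<close> is admissible and bounds both
  \<open>S I\<close> and \<open>- S I\<close> by zero.\<close>

lemma P_cone_pointed:
  assumes "n < N" "x \<in> P_cone N n" "- x \<in> P_cone N n"
  shows "x = 0"
proof -
  obtain S w where x: "x = (S, w)"
    by (cases x)
  have P: "(S, w) \<in> P_cone N n" "(- S, - w) \<in> P_cone N n"
    using assms(2,3) by (simp_all add: x)
  have "w e = 0" for e
  proof (cases "e \<in> edges N")
    case True
    then have "0 \<le> w e" "0 \<le> (- w) e"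
      using P by (simp_all add: mem_P_cone)
    then show ?thesis by simp
  next
    case False
    then show ?thesis
      using P(1) by (auto simp: mem_P_cone intro: vecs_outside)
  qed
  then have w: "w = 0"
    by (simp add: fun_eq_iff)
  have "S I = 0" for I
  proof (cases "I \<in> terminal_sets n")
    case True
    then have "T I \<le> 0" if "(T, 0) \<in> P_cone N n" for T
      using that terminal_sets_subset[OF True assms(1)]
      by (auto simp: P_cone_def)
    from this[of S] this[of "- S"] show ?thesis
      using P by (simp add: w)
  next
    case False
    then show ?thesis
      using P(1) by (auto simp: mem_P_cone intro: vecs_outside)
  qed
  then show ?thesis
    by (simp add: x w zero_prod_def fun_eq_iff)
qed

lemma V_description_P_cone: "n < N \<Longrightarrow> V_description (extreme_rays (P_cone N n)) (P_cone N n)"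
  using P_cone_finitely_generated[of N n] P_cone_pointed[of n N]
  by (blast intro: V_description_finitely_generated)

text \<open>
  If \<open>S I\<close> were smaller than every cut separating \<open>I\<close>, then \<open>(S, w)\<close> could be split as
  \<open>(S + d \<cdot> unit_vec I, w) + (- d \<cdot> unit_vec I, 0)\<close>, and extremality would make the ray trivial.
\<close>

lemma nontrivial_extreme_ray_realizes:
  assumes "n < N" and r: "r \<in> extreme_rays (P_cone N n)" "r \<notin> trivial_rays N n"
    and x: "(S, w) \<in> r"
  shows "realizes n N w S"
proof -
  obtain z where z: "r = conic hull {z}" and face: "r face_of P_cone N n"
    using r(1) by (rule extreme_raysE)
  have P: "(S, w) \<in> P_cone N n"
    using face_of_imp_subset[OF face] x by blast
  have "\<exists>W. W \<subseteq> {1..N - 1} \<and> W \<inter> {1..n} = I \<and> S I = cut_weight N w W"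
    if I: "I \<in> terminal_sets n" for I
  proof (rule ccontr)
    assume no: "\<not> ?thesis"
    define X where "X = {cut_weight N w W - S I |W. W \<subseteq> {1..N - 1} \<and> W \<inter> {1..n} = I}"
    \<comment> \<open>The least slack among the cuts with trace \<open>I\<close>: positive because
      none is tight, and small enough that raising \<open>S I\<close> by \<open>d\<close> keeps all
      inequalities.\<close>
    define d where "d = Min X"
    have "finite X"
      unfolding X_def by (rule finite_subset[of _ "(\<lambda>W. cut_weight N w W - S I) ` Pow {1..N - 1}"]) auto
    moreover have "cut_weight N w I - S I \<in> X"
      unfolding X_def using terminal_sets_subset[OF I assms(1)] by blast
    ultimately have "d \<in> X" and d_le: "y \<in> X \<Longrightarrow> d \<le> y" for y
      unfolding d_def by (auto intro: Min_in)
    moreover have "0 < y" if y: "y \<in> X" for y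
    proof -
      obtain W where W: "W \<subseteq> {1..N - 1}" "W \<inter> {1..n} = I" "y = cut_weight N w W - S I"
        using y by (auto simp: X_def)
      moreover have "S I \<le> cut_weight N w W"
        using P I W by (auto simp: P_cone_def)
      moreover have "S I \<noteq> cut_weight N w W"
        using no W by blast
      ultimately show ?thesis by simp
    qed
    ultimately have d: "0 < d" by blast
    define a where "a = (S + d *\<^sub>R unit_vec I, w)"
    define b where "b = (- unit_vec I :: nat set \<Rightarrow> real, 0 :: nat \<times> nat \<Rightarrow> real)"
    have unit: "(d *\<^sub>R unit_vec I) J = (if J = I then d else 0)" for J
      by simp
    have sub: "unit_vec I \<in> vecs (terminal_sets n)"
      by (rule unit_vec_vecs[OF I])
    have "a \<in> P_cone N n"
      unfolding a_def mem_P_cone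
    proof (intro conjI allI impI)
      fix W assume W: "W \<subseteq> {1..N - 1} \<and> W \<inter> {1..n} \<noteq> {}"
      show "(S + d *\<^sub>R unit_vec I) (W \<inter> {1..n}) \<le> cut_weight N w W"
      proof (cases "W \<inter> {1..n} = I")
        case True
        then have "d \<le> cut_weight N w W - S I"
          using W by (intro d_le) (auto simp: X_def)
        then show ?thesis
          using True by (simp add: unit)
      next
        case False
        then show ?thesis
          using P W by (simp add: mem_P_cone unit)
      qed
    qed (use P sub in \<open>auto simp: mem_P_cone subspace_add[OF subspace_vecs] subspace_scale[OF subspace_vecs]\<close>)
    moreover have b: "b \<in> P_cone N n"
      using sub by (auto simp: b_def mem_P_cone 
          subspace_0[OF subspace_vecs] subspace_neg[OF subspace_vecs])
    moreover have "d *\<^sub>R b + a = (S, w)"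
      by (simp add: a_def b_def)
    moreover have "conic (P_cone N n)"
      using P_cone_finitely_generated[of N n] conic_convex_cone_hull by metis
    ultimately have "d *\<^sub>R b \<in> r"
      using face_of_conic_addD[OF face, of "d *\<^sub>R b" a] d x z
      by (simp add: conic_mul conic_conic_hull)
    then have "b \<in> r"
      using conic_mul[of r "d *\<^sub>R b" "1 / d"] d z by (simp add: conic_conic_hull)
    moreover have "b \<noteq> 0"
      by (auto simp: b_def zero_prod_def fun_eq_iff)
    ultimately have "r = conic hull {b}"
      using conic_hull_singleton_eqI z by metis
    then show False
      using r(2) I by (auto simp: trivial_rays_def b_def)
  qed
  then show ?thesis
    using P assms(1) by (simp add: realizes_iff)
qed

text \<open>
  Trivial rays only decrease \<open>S\<close> or increase \<open>w\<close>, so they cannot contribute to the \<open>S\<close>-part of a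
  point where every \<open>S I\<close> equals a minimum cut.
\<close>

lemma realizes_imp_mem_nontrivial_hull:
  assumes "realizes n N w S"
  shows "S \<in> fst ` (convex_cone hull (\<Union>(extreme_rays (P_cone N n) - trivial_rays N n)))"
proof -
  let ?E = "extreme_rays (P_cone N n)" and ?T = "trivial_rays N n"
  \<comment> \<open>A convex cone containing all trivial rays; apart from the support of
    \<open>U\<close> it records only the signs of the two parts.\<close>
  let ?D = "{(U :: nat set \<Rightarrow> real, v :: nat \<times> nat \<Rightarrow> real).
    U \<in> vecs (terminal_sets n) \<and> (\<forall>I. U I \<le> 0) \<and> (\<forall>e. 0 \<le> v e)}"
  have nN: "n < N" and P: "(S, w) \<in> P_cone N n"
    using assms by (auto simp: realizes_iff)
  have PE: "P_cone N n = convex_cone hull (\<Union>?E)"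
    using V_description_P_cone[OF nN] by (simp add: V_description_def)
  have D: "convex_cone ?D"
    by (auto simp: convex_cone_iff zero_prod_def add_nonpos_nonpos mult_nonneg_nonpos
        subspace_0[OF subspace_vecs] subspace_add[OF subspace_vecs] subspace_scale[OF subspace_vecs])
  have "s \<subseteq> ?D" if "s \<in> ?T" for s
  proof -
    have "\<exists>t\<in>?D. s = conic hull {t}"
      using that unfolding trivial_rays_def
    proof (elim UnE CollectE exE conjE)
      fix I assume "s = conic hull {(- unit_vec I, 0)}" "I \<in> terminal_sets n"
      then show ?thesis
        by (intro bexI[of _ "(- unit_vec I, 0)"]) (auto simp: vecs_def)
    next
      fix e assume "s = conic hull {(0, unit_vec e)}" "e \<in> edges N"
      then show ?thesis
        by (intro bexI[of _ "(0, unit_vec e)"]) (auto simp: vecs_def)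
    qed
    then obtain t where "s = conic hull {t}" "t \<in> ?D"
      by blast
    then show ?thesis
      using D by (simp add: convex_cone_def subset_hull)
  qed
  then have "convex_cone hull (\<Union>(?E \<inter> ?T)) \<subseteq> ?D"
    using D by (subst convex_cone_hull_subset_iff) blast+
  moreover have "(S, w) \<in> convex_cone hull (\<Union>(?E - ?T) \<union> \<Union>(?E \<inter> ?T))"
  proof -
    have "\<Union>(?E - ?T) \<union> \<Union>(?E \<inter> ?T) = \<Union>?E"
      by blast
    then show ?thesis
      using P by (subst (asm) PE) simp
  qed
  ultimately obtain a U v where a: "a \<in> convex_cone hull (\<Union>(?E - ?T))"
      and U: "(S, w) = a + (U, v)" "U \<in> vecs (terminal_sets n)" "\<And>I. U I \<le> 0" "\<And>e. 0 \<le> v e"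
    by (elim convex_cone_hull_UnE) blast
  have aP: "a \<in> P_cone N n"
    using a hull_mono[of "\<Union>(?E - ?T)" "\<Union>?E" convex_cone] PE by blast
  obtain A b where ab: "a = (A, b)" by (cases a)
  have S: "S = A + U" and w: "w = b + v"
    using U(1) by (simp_all add: ab)
  \<comment> \<open>At a cut \<open>W\<close> attaining \<open>S I\<close>, feasibility of
    \<open>a\<close> and \<open>v \<ge> 0\<close> give \<open>A I \<le> S I\<close>. Since
    \<open>S = A + U\<close> with \<open>U \<le> 0\<close>, equality follows.\<close>
  have "U I = 0" for I
  proof (cases "I \<in> terminal_sets n")
    case True
    then obtain W where W: "W \<subseteq> {1..N - 1}" "W \<inter> {1..n} = I" "S I = cut_weight N w W"
      using assms unfolding realizes_iff by metis
    then have "A I \<le> cut_weight N b W"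
      using aP True by (auto simp: ab P_cone_def)
    also have "\<dots> \<le> cut_weight N w W"
      using cut_weight_nonneg[of N v W] U(4) by (simp add: w cut_weight_add)
    finally show ?thesis
      using W(3) U(3)[of I] by (simp add: S)
  next
    case False
    then show ?thesis
      by (rule vecs_outside[OF U(2)])
  qed
  then have "S = fst a"
    by (simp add: S ab fun_eq_iff)
  then show ?thesis
    using a by blast
qed

section \<open>Projection to the \<open>S\<close> coordinates\<close>

lemma projected_rays_halfline: "s \<in> projected_rays n \<Longrightarrow> \<exists>y. s = conic hull {y}"
  unfolding projected_rays_def
  by (auto dest!: extreme_rays_halfline simp: linear_image_conic_hull_singleton[OF linear_fst])

text \<open>Non-trivial extreme rays consist of realizations and \<open>H_cone n\<close> is a convex
  cone, which gives one inclusion. For the other, all of \<open>H_cone n\<close> is realized on the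
  same \<open>m_min n\<close> vertices, so a single \<open>P_cone\<close> suffices.\<close>

lemma H_cone_eq_hull_projected_rays: "H_cone n = convex_cone hull (\<Union>(projected_rays n))"
proof
  let ?R = "extreme_rays (P_cone (m_min n) n) - trivial_rays (m_min n) n"
  have proj: "\<Union>(projected_rays n) = fst ` \<Union>?R"
    by (auto simp: projected_rays_def)
  have "\<Union>(projected_rays n) \<subseteq> H_cone n"
  proof
    fix S assume "S \<in> \<Union>(projected_rays n)"
    then obtain r w where "r \<in> ?R" "(S, w) \<in> r"
      unfolding proj by force
    then have "realizes n (m_min n) w S"
      using nontrivial_extreme_ray_realizes[OF m_min_gt] by blast
    then show "S \<in> H_cone n"
      by (auto simp: H_cone_def)
  qed
  then show "convex_cone hull (\<Union>(projected_rays n)) \<subseteq> H_cone n"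
    by (simp add: convex_cone_hull_subset_iff convex_cone_H_cone)
  show "H_cone n \<subseteq> convex_cone hull (\<Union>(projected_rays n))"
  proof
    fix S assume "S \<in> H_cone n"
    then obtain w where "realizes n (m_min n) w S"
      using realizes_m_min by blast
    then show "S \<in> convex_cone hull (\<Union>(projected_rays n))"
      unfolding proj convex_cone_hull_linear_image[OF linear_fst]
      by (rule realizes_imp_mem_nontrivial_hull)
  qed
qed

theorem corollary3:
  fixes n :: nat
  assumes "n \<ge> 2"
  shows "finite (projected_rays n)
    \<and> H_cone n = convex_cone hull (\<Union>(projected_rays n))
    \<and> remove_redundant (projected_rays n) = extreme_rays (H_cone n)
    \<and> V_description (remove_redundant (projected_rays n)) (H_cone n)"
proof -
  have fin: "finite (projected_rays n)"
    using V_description_P_cone[OF m_min_gt[of n]] by (simp add: projected_rays_def V_description_def)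
  have eq: "remove_redundant (projected_rays n) = extreme_rays (H_cone n)"
    by (rule remove_redundant_eq_extreme_rays[OF projected_rays_halfline
          H_cone_eq_hull_projected_rays H_cone_pointed])
  \<comment> \<open>Finiteness of the projected family ensures that discarding all redundant rays at
    once keeps the hull.\<close>
  have "V_description (extreme_rays (H_cone n)) (H_cone n)"
    by (rule V_description_extreme_rays[OF fin projected_rays_halfline
          H_cone_eq_hull_projected_rays H_cone_pointed])
  then show ?thesis
    using fin eq H_cone_eq_hull_projected_rays by simp
qed

end
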